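(* Let $\nu$ be a finitely-supported probability measure on $\mathbb{R}$. Then \[ T(\mu_\nu) \ll \|\nu\|_2^4 M(\nu)^{1/2} + \|\nu\|_\infty^2 M(\nu) + \|\nu\|_2^6 + \nu(0)^3, \] where the implied constant is absolute.
   Context: For a finitely-supported probability measure $\nu$ on $\mathbb{R}$, let $\mu_\nu$ be the probability measure on $\mathrm{Mat}_2(\mathbb{R})$ (the $2\times 2$ real matrices) given by $\mu_\nu\big((a_{i,j})_{1\le i,j\le 2}\big) = \nu(a_{1,1})\nu(a_{1,2})\nu(a_{2,1})\nu(a_{2,2})$. For a finitely-supported probability measure $\mu$ on $\mathrm{Mat}_2(\mathbb{R})$, $T(\mu) = \sum_{X,Y\in\mathrm{supp}(\mu)}\mu(X)\mu(Y)\mathbb{1}_{XY=YX}$. The multiplicative energy is \[ M(\nu) = \sum_{a_1,a_2,a_3,a_4 \in \mathrm{supp}(\nu)\setminus\{0\}} \nu(a_1)\nu(a_2)\nu(a_3)\nu(a_4)\,\mathbb{1}_{a_1/a_2 = a_3/a_4}, \] $\|\nu\|_p = (\sum_{x\in\mathrm{supp}(\nu)}\nu(x)^p)^{1/p}$ for $1\le p<\infty$, and $\|\nu\|_\infty = \max_{x}\nu(x)$. The notation $Y\ll X$ means $|Y|\le CX$ for some constant $C>0$. *)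

theory Defs
  imports "HOL-Probability.Probability"
begin

text \<open>
  Finitely supported probability measures are represented by probability mass functions
  with finite support, so that \<open>pmf \<nu> x\<close> is the mass of the point \<open>x\<close> and
  \<open>set_pmf \<nu>\<close> is the support.
\<close>

definition mat_pmf :: "real pmf \<Rightarrow> (real^2^2) pmf" where
  "mat_pmf \<nu> = embed_pmf (\<lambda>A. pmf \<nu> (A$1$1) * pmf \<nu> (A$1$2) * pmf \<nu> (A$2$1) * pmf \<nu> (A$2$2))"

definition commuting_prob :: "(real^2^2) pmf \<Rightarrow> real" where
  "commuting_prob \<mu> =
     (\<Sum>X\<in>set_pmf \<mu>. \<Sum>Y\<in>set_pmf \<mu>. pmf \<mu> X * pmf \<mu> Y * of_bool (X ** Y = Y ** X))"

definition mult_energy :: "real pmf \<Rightarrow> real" where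
  "mult_energy \<nu> =
     (\<Sum>a1\<in>set_pmf \<nu> - {0}. \<Sum>a2\<in>set_pmf \<nu> - {0}. \<Sum>a3\<in>set_pmf \<nu> - {0}. \<Sum>a4\<in>set_pmf \<nu> - {0}.
        pmf \<nu> a1 * pmf \<nu> a2 * pmf \<nu> a3 * pmf \<nu> a4 * of_bool (a1 / a2 = a3 / a4))"

definition lp_norm :: "real \<Rightarrow> real pmf \<Rightarrow> real" where
  "lp_norm p \<nu> = (\<Sum>x\<in>set_pmf \<nu>. pmf \<nu> x powr p) powr (1 / p)"

definition linf_norm :: "real pmf \<Rightarrow> real" where
  "linf_norm \<nu> = Max (range (pmf \<nu>))"

text \<open>The function embedded in \<open>mat_pmf\<close> is a genuine mass function.\<close>

lemma pmf_mat_pmf: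
  "pmf (mat_pmf \<nu>) A = pmf \<nu> (A$1$1) * pmf \<nu> (A$1$2) * pmf \<nu> (A$2$1) * pmf \<nu> (A$2$2)"
proof -
  define f :: "(real \<times> real) \<times> (real \<times> real) \<Rightarrow> real^2^2"
    where "f = (\<lambda>((a, b), (c, d)). vector [vector [a, b], vector [c, d]])"
  define P where "P = map_pmf f (pair_pmf (pair_pmf \<nu> \<nu>) (pair_pmf \<nu> \<nu>))"
  have entries: "f ((a, b), (c, d)) $ 1 $ 1 = a" "f ((a, b), (c, d)) $ 1 $ 2 = b"
      "f ((a, b), (c, d)) $ 2 $ 1 = c" "f ((a, b), (c, d)) $ 2 $ 2 = d" for a b c d
    by (simp_all add: f_def)
  have "inj f"
    by (rule injI) (metis entries prod.collapse)
  have f_entries: "f ((B$1$1, B$1$2), (B$2$1, B$2$2)) = B" for B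
    by (simp add: vec_eq_iff forall_2 entries)
  have P: "pmf P B = pmf \<nu> (B$1$1) * pmf \<nu> (B$1$2) * pmf \<nu> (B$2$1) * pmf \<nu> (B$2$2)" for B
  proof -
    have "pmf P (f ((B$1$1, B$1$2), (B$2$1, B$2$2))) =
        pmf \<nu> (B$1$1) * pmf \<nu> (B$1$2) * (pmf \<nu> (B$2$1) * pmf \<nu> (B$2$2))"
      unfolding P_def by (subst pmf_map_inj'[OF \<open>inj f\<close>]) (simp add: pmf_pair)
    then show ?thesis by (simp add: f_entries mult.assoc)
  qed
  have "mat_pmf \<nu> = embed_pmf (pmf P)"
    unfolding mat_pmf_def by (rule arg_cong[where f = embed_pmf]) (simp add: P fun_eq_iff)
  also have "\<dots> = P"
    by (rule td_pmf_embed_pmf[THEN type_definition.Rep_inverse])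
  finally show ?thesis by (simp add: P)
qed

end

theory Submission
  imports Defs
begin

text \<open>
  Two matrices commute iff their vectors (difference of the diagonal entries, two off-diagonal
  entries) in \<open>\<real>\<^sup>3\<close> are parallel. If an off-diagonal entry vanishes, the contribution is at
  most \<open>\<nu>(0)\<^sup>4 + 4 \<nu>(0)\<^sup>2 N\<close> with \<open>N = \<parallel>\<nu>\<parallel>\<^sub>2\<^sup>2\<close>. Otherwise the vectors have a nonzero ratio \<open>\<lambda>\<close>, and
  the contribution is the sum of \<open>r(\<lambda>)\<^sup>2 s(\<lambda>)\<close>, where \<open>r(\<lambda>)\<close> is the mass of pairs of ratio \<open>\<lambda>\<close>, so
  that the sum of \<open>r(\<lambda>)\<^sup>2\<close> is \<open>M(\<nu>)\<close>, and \<open>s(\<lambda>)\<close> is the probability that two points drawn from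
  \<open>\<nu> \<times> \<nu>\<close> lie on a common line of slope \<open>\<lambda>\<close>.

  The sum of \<open>s\<close> over a set \<open>L\<close> of slopes is \<open>O(N |L|\<^sup>1\<^sup>/\<^sup>2 + N\<^sup>2 |L|)\<close>. This replaces the
  Szemeredi-Trotter theorem, and for a product set it is elementary: cut the line into \<open>O(t)\<close>
  intervals that are single atoms or have mass below \<open>1/t\<close>. A line meets \<open>O(t)\<close> cells of the product
  partition, so by Cauchy-Schwarz \<open>s(\<lambda>)\<close> is at most \<open>O(t)\<close> times the mass of collinear pairs in a
  common cell. Equal points contribute \<open>N\<^sup>2\<close> for each \<open>\<lambda>\<close>, and distinct ones determine \<open>\<lambda>\<close> and
  contribute at most \<open>1/t\<^sup>2\<close> in total; then optimise \<open>t\<close>. Finally decompose dyadically by the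
  size of \<open>r \<le> N\<close>.
\<close>

section \<open>Weighted collision sums\<close>

text \<open>Expand each squared fibre mass and exchange sums: a pair \<open>p\<close>,
  \<open>q\<close> survives only at the class \<open>c = k p = k q\<close>. The weight
  \<open>g\<close> will be the slope energy, with \<open>k\<close> the ratio of a pair.\<close>

lemma collision_sum_weighted:
  fixes w :: "'a \<Rightarrow> real"
  assumes "finite P" "finite K" "k ` P \<subseteq> K"
  shows "(\<Sum>p\<in>P. \<Sum>q\<in>P. w p * w q * (of_bool (k p = k q) * g (k p))) =
    (\<Sum>c\<in>K. (\<Sum>p | p \<in> P \<and> k p = c. w p)\<^sup>2 * g c)"
proof -
  have "(\<Sum>p | p \<in> P \<and> k p = c. w p) = (\<Sum>p\<in>P. w p * of_bool (k p = c))" for c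
    by (subst sum.inter_filter[OF assms(1)], intro sum.cong) auto
  then have "(\<Sum>c\<in>K. (\<Sum>p | p \<in> P \<and> k p = c. w p)\<^sup>2 * g c) =
      (\<Sum>c\<in>K. \<Sum>p\<in>P. \<Sum>q\<in>P. (w p * of_bool (k p = c)) * (w q * of_bool (k q = c)) * g c)"
    by (simp only: power2_eq_square sum_product) (simp only: sum_distrib_right)
  also have "\<dots> = (\<Sum>p\<in>P. \<Sum>q\<in>P. \<Sum>c\<in>K. (w p * of_bool (k p = c)) * (w q * of_bool (k q = c)) * g c)"
    by (subst sum.swap, rule sum.cong[OF refl], subst sum.swap) simp
  also have "\<dots> = (\<Sum>p\<in>P. \<Sum>q\<in>P. w p * w q * (of_bool (k p = k q) * g (k p)))"
  proof (intro sum.cong refl)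
    fix p q assume "p \<in> P" "q \<in> P"
    have "(\<Sum>c\<in>K. (w p * of_bool (k p = c)) * (w q * of_bool (k q = c)) * g c) =
        (\<Sum>c\<in>K. if k p = c then w p * w q * (of_bool (k p = k q) * g (k p)) else 0)"
      by (intro sum.cong) auto
    also have "\<dots> = w p * w q * (of_bool (k p = k q) * g (k p))"
      using assms \<open>p \<in> P\<close> by auto
    finally show "(\<Sum>c\<in>K. (w p * of_bool (k p = c)) * (w q * of_bool (k q = c)) * g c) =
        w p * w q * (of_bool (k p = k q) * g (k p))" .
  qed
  finally show ?thesis by simp
qed

lemma collision_sum:
  fixes w :: "'a \<Rightarrow> real"
  assumes "finite P" "finite K" "k ` P \<subseteq> K"
  shows "(\<Sum>p\<in>P. \<Sum>q\<in>P. w p * w q * of_bool (k p = k q)) =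
    (\<Sum>c\<in>K. (\<Sum>p | p \<in> P \<and> k p = c. w p)\<^sup>2)"
  using collision_sum_weighted[OF assms, of w "\<lambda>_. 1"] by simp

text \<open>Cauchy-Schwarz on each fibre of \<open>k\<close>: \<phi> cuts it into at most
  \<open>card L\<close> pieces, so requiring \<phi> to agree as well costs a factor
  \<open>card L\<close> at most.\<close>

lemma collision_sum_refine:
  fixes w :: "'a \<Rightarrow> real"
  assumes "finite P" "finite L" "\<phi> ` P \<subseteq> L"
  shows "(\<Sum>p\<in>P. \<Sum>q\<in>P. w p * w q * of_bool (k p = k q)) \<le>
    card L * (\<Sum>p\<in>P. \<Sum>q\<in>P. w p * w q * of_bool (k p = k q \<and> \<phi> p = \<phi> q))"
proof -
  have split: "(\<Sum>p | p \<in> P \<and> k p = c. w p) = (\<Sum>l\<in>L. \<Sum>p | p \<in> P \<and> (k p, \<phi> p) = (c, l). w p)" for c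
  proof -
    have "(\<Sum>p | p \<in> P \<and> k p = c. w p) =
        (\<Sum>l\<in>L. \<Sum>p | p \<in> {p \<in> P. k p = c} \<and> \<phi> p = l. w p)"
      using assms by (intro sum.group[symmetric]) auto
    also have "\<dots> = (\<Sum>l\<in>L. \<Sum>p | p \<in> P \<and> (k p, \<phi> p) = (c, l). w p)"
      by (intro sum.cong) auto
    finally show ?thesis .
  qed
  have "(\<Sum>p\<in>P. \<Sum>q\<in>P. w p * w q * of_bool (k p = k q)) =
      (\<Sum>c\<in>k ` P. (\<Sum>p | p \<in> P \<and> k p = c. w p)\<^sup>2)"
    using assms by (intro collision_sum) auto
  also have "\<dots> \<le> (\<Sum>c\<in>k ` P. (\<Sum>l\<in>L. (\<Sum>p | p \<in> P \<and> (k p, \<phi> p) = (c, l). w p)\<^sup>2) * card L)"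
    unfolding split by (intro sum_mono sum_squared_le_sum_of_squares assms)
  also have "\<dots> = card L * (\<Sum>cl\<in>k ` P \<times> L. (\<Sum>p | p \<in> P \<and> (k p, \<phi> p) = cl. w p)\<^sup>2)"
    by (simp only: sum_distrib_left[symmetric] sum.cartesian_product' mult.commute)
  also have "(\<Sum>cl\<in>k ` P \<times> L. (\<Sum>p | p \<in> P \<and> (k p, \<phi> p) = cl. w p)\<^sup>2) =
      (\<Sum>p\<in>P. \<Sum>q\<in>P. w p * w q * of_bool ((k p, \<phi> p) = (k q, \<phi> q)))"
    using assms by (intro collision_sum[symmetric]) auto
  finally show ?thesis by simp
qed

section \<open>Dyadic decomposition\<close>

text \<open>Induction on the number \<open>n\<close> of dyadic levels of \<open>r\<close>: the top
  level is estimated through its cardinality, the rest by induction with \<open>R\<close> halved.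
  The \<open>A\<close> terms form a geometric series and the \<open>B\<close> terms add up, so the
  bound does not depend on \<open>n\<close>.\<close>

lemma sum_square_weight_le:
  fixes r s :: "'a \<Rightarrow> real" and A B R :: real
  assumes "finite L" and A: "A \<ge> 0" and B: "B \<ge> 0" and R: "R > 0"
    and s: "\<And>l. l \<in> L \<Longrightarrow> s l \<ge> 0"
    and sub: "\<And>L'. L' \<subseteq> L \<Longrightarrow> (\<Sum>l\<in>L'. s l) \<le> A * sqrt (card L') + B * card L'"
    and r: "\<And>l. l \<in> L \<Longrightarrow> R / 2 ^ n < r l" "\<And>l. l \<in> L \<Longrightarrow> r l \<le> R"
  shows "(\<Sum>l\<in>L. (r l)\<^sup>2 * s l) \<le> 4 * A * R * sqrt (\<Sum>l\<in>L. (r l)\<^sup>2) + 4 * B * (\<Sum>l\<in>L. (r l)\<^sup>2)"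
  using assms
proof (induction n arbitrary: L R)
  case 0
  then have "L = {}" by (force simp: not_less)
  then show ?case by simp
next
  case (Suc n)
  note pos = Suc.prems(2-4) and s = Suc.prems(5) and sub = Suc.prems(6) and r = Suc.prems(7,8)
  define L1 where "L1 = {l \<in> L. r l > R / 2}"
  define L2 where "L2 = {l \<in> L. r l \<le> R / 2}"
  define M1 where "M1 = (\<Sum>l\<in>L1. (r l)\<^sup>2)"
  define M2 where "M2 = (\<Sum>l\<in>L2. (r l)\<^sup>2)"
  define M where "M = (\<Sum>l\<in>L. (r l)\<^sup>2)"
  have L: "L = L1 \<union> L2" "L1 \<inter> L2 = {}" "finite L1" "finite L2" "L1 \<subseteq> L" "L2 \<subseteq> L"
    using Suc.prems(1) by (auto simp: L1_def L2_def)
  have M: "M = M1 + M2" and "M1 \<ge> 0" "M2 \<ge> 0"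
    unfolding M_def M1_def M2_def using L by (auto simp: sum.union_disjoint intro: sum_nonneg)
  have 2: "(\<Sum>l\<in>L2. (r l)\<^sup>2 * s l) \<le> 4 * A * (R / 2) * sqrt M2 + 4 * B * M2"
    unfolding M2_def
  proof (rule Suc.IH)
    show "(\<Sum>l\<in>L'. s l) \<le> A * sqrt (card L') + B * card L'" if "L' \<subseteq> L2" for L'
      using that L by (intro sub) auto
    show "R / 2 / 2 ^ n < r l" "r l \<le> R / 2" "s l \<ge> 0" if "l \<in> L2" for l
      using that r(1)[of l] s[of l] by (auto simp: L2_def)
  qed (use pos L in auto)
  \<comment> \<open>Chebyshev: elements with \<open>r l > R / 2\<close> are few, since each adds at
    least a quarter of the square of \<open>R\<close> to \<open>M1\<close>.\<close>
  have "card L1 * (R / 2)\<^sup>2 = (\<Sum>l\<in>L1. (R / 2)\<^sup>2)" by simp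
  also have "\<dots> \<le> M1"
    unfolding M1_def using pos by (intro sum_mono power_mono) (auto simp: L1_def)
  finally have c: "card L1 * R\<^sup>2 \<le> 4 * M1" by (simp add: power_divide)
  have "(sqrt (card L1) * R)\<^sup>2 \<le> (2 * sqrt M1)\<^sup>2"
    using c \<open>M1 \<ge> 0\<close> by (simp add: power_mult_distrib)
  then have c': "sqrt (card L1) * R \<le> 2 * sqrt M1"
    by (rule power2_le_imp_le) (use \<open>M1 \<ge> 0\<close> in auto)
  have "(\<Sum>l\<in>L1. (r l)\<^sup>2 * s l) \<le> (\<Sum>l\<in>L1. R\<^sup>2 * s l)"
  proof (intro sum_mono mult_right_mono power_mono)
    fix l assume l: "l \<in> L1"
    then have "l \<in> L" using L by auto
    then show "r l \<le> R" "0 \<le> s l" using r s by auto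
    show "0 \<le> r l" using l \<open>R > 0\<close> by (auto simp: L1_def)
  qed
  also have "\<dots> = R\<^sup>2 * (\<Sum>l\<in>L1. s l)" by (simp add: sum_distrib_left)
  also have "\<dots> \<le> R\<^sup>2 * (A * sqrt (card L1) + B * card L1)"
    using L by (intro mult_left_mono sub) auto
  also have "\<dots> = A * R * (sqrt (card L1) * R) + B * (card L1 * R\<^sup>2)"
    by (simp add: algebra_simps power2_eq_square)
  also have "\<dots> \<le> A * R * (2 * sqrt M1) + B * (4 * M1)"
    using c c' pos by (intro add_mono mult_left_mono) auto
  finally have 1: "(\<Sum>l\<in>L1. (r l)\<^sup>2 * s l) \<le> 2 * A * R * sqrt M1 + 4 * B * M1"
    by (simp add: algebra_simps)
  \<comment> \<open>The top level costs \<open>2 * A * R * sqrt M\<close>, the induction hypothesis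
    at \<open>R / 2\<close> the same again; this is why the constant 4 reproduces itself.\<close>
  have "A * R * sqrt M1 \<le> A * R * sqrt M" "A * R * sqrt M2 \<le> A * R * sqrt M"
    using M \<open>M1 \<ge> 0\<close> \<open>M2 \<ge> 0\<close> pos by (auto intro!: mult_left_mono)
  moreover have "(\<Sum>l\<in>L. (r l)\<^sup>2 * s l) = (\<Sum>l\<in>L1. (r l)\<^sup>2 * s l) + (\<Sum>l\<in>L2. (r l)\<^sup>2 * s l)"
    using L by (simp add: sum.union_disjoint)
  ultimately have "(\<Sum>l\<in>L. (r l)\<^sup>2 * s l) \<le> 4 * (A * R * sqrt M) + 4 * B * M"
    using 1 2 by (simp add: M algebra_simps)
  then show ?case by (simp add: M_def mult.assoc)
qed

section \<open>Product weights, lines and ratios\<close>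

locale finite_weight =
  fixes S :: "real set" and f :: "real \<Rightarrow> real"
  assumes fin: "finite S" and pos: "x \<in> S \<Longrightarrow> f x > 0" and total: "sum f S = 1"
begin

definition sq_mass :: real where
  "sq_mass = (\<Sum>x\<in>S. (f x)\<^sup>2)"

definition w :: "real \<times> real \<Rightarrow> real" where
  "w p = f (fst p) * f (snd p)"

text \<open>This is the \<open>s\<close> of the overview. Lines are written as x = l y + const, so
  that \<open>l\<close> is a ratio of first to second coordinates, as in \<open>ratio_mass\<close>
  (the \<open>r\<close> of the overview).\<close>

definition slope_energy :: "real \<Rightarrow> real" where
  "slope_energy l = (\<Sum>p\<in>S \<times> S. \<Sum>q\<in>S \<times> S.
     w p * w q * of_bool (fst p - l * snd p = fst q - l * snd q))"

definition ratio_mass :: "real \<Rightarrow> real" where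
  "ratio_mass l = (\<Sum>p | p \<in> (S - {0}) \<times> (S - {0}) \<and> fst p / snd p = l. w p)"

definition ratios :: "real set" where
  "ratios = (\<lambda>p. fst p / snd p) ` ((S - {0}) \<times> (S - {0}))"

lemma nonneg: "x \<in> S \<Longrightarrow> f x \<ge> 0"
  using pos less_imp_le by blast

lemma w_nonneg: "p \<in> S \<times> S \<Longrightarrow> w p \<ge> 0"
  by (auto simp: w_def nonneg)

lemma sum_w: "sum w (S \<times> S) = 1"
  using total by (simp add: w_def sum.cartesian_product' sum_distrib_left[symmetric])

lemma sum_w_sq: "(\<Sum>p\<in>S \<times> S. (w p)\<^sup>2) = sq_mass\<^sup>2"
  by (simp add: w_def sum.cartesian_product' power_mult_distrib sum_distrib_left[symmetric]
      sum_distrib_right[symmetric] sq_mass_def power2_eq_square[of "sum _ _"])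

lemma sq_mass_nonneg: "sq_mass \<ge> 0"
  by (simp add: sq_mass_def sum_nonneg)

lemma sq_mass_pos: "sq_mass > 0"
proof -
  have "S \<noteq> {}" using total by auto
  then show ?thesis unfolding sq_mass_def
    using fin pos by (intro sum_pos zero_less_power) auto
qed

lemma slope_energy_nonneg: "slope_energy l \<ge> 0"
  unfolding slope_energy_def using w_nonneg by (intro sum_nonneg) auto

text \<open>By AM-GM \<open>w p\<close> is at most the mean of the squared weights of its
  coordinates, and injectivity lets each coordinate occur once. It serves lines through the origin
  (\<open>ratio_mass\<close>) and general ones (\<open>slope_energy\<close>).\<close>

lemma line_mass_le:
  assumes "P \<subseteq> S \<times> S" "inj_on fst P" "inj_on snd P"
  shows "sum w P \<le> sq_mass"
proof -
  have P: "finite P" using assms(1) fin by (meson finite_SigmaI finite_subset)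
  have "sum w P \<le> (\<Sum>p\<in>P. ((f (fst p))\<^sup>2 + (f (snd p))\<^sup>2) / 2)"
    using sum_squares_bound by (intro sum_mono) (auto simp: w_def field_simps)
  also have "\<dots> = ((\<Sum>p\<in>P. (f (fst p))\<^sup>2) + (\<Sum>p\<in>P. (f (snd p))\<^sup>2)) / 2"
    by (simp add: sum.distrib sum_divide_distrib[symmetric])
  also have "(\<Sum>p\<in>P. (f (fst p))\<^sup>2) = (\<Sum>x\<in>fst ` P. (f x)\<^sup>2)"
    using assms by (simp add: sum.reindex)
  also have "\<dots> \<le> sq_mass"
    unfolding sq_mass_def using assms fin by (intro sum_mono2) auto
  also have "(\<Sum>p\<in>P. (f (snd p))\<^sup>2) = (\<Sum>x\<in>snd ` P. (f x)\<^sup>2)"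
    using assms by (simp add: sum.reindex)
  also have "\<dots> \<le> sq_mass"
    unfolding sq_mass_def using assms fin by (intro sum_mono2) auto
  finally show ?thesis by simp
qed

text \<open>Fix \<open>p\<close>: the admissible \<open>q\<close> lie on one line, which for
  \<open>l\<close> nonzero projects injectively to both axes.\<close>

lemma slope_energy_le:
  assumes "l \<noteq> 0"
  shows "slope_energy l \<le> sq_mass"
proof -
  have "slope_energy l =
      (\<Sum>p\<in>S \<times> S. w p * (\<Sum>q | q \<in> S \<times> S \<and> fst p - l * snd p = fst q - l * snd q. w q))"
    unfolding slope_energy_def using fin
    by (simp add: sum.inter_filter sum_distrib_left of_bool_def if_distrib mult.assoc cong: if_cong)
  also have "\<dots> \<le> (\<Sum>p\<in>S \<times> S. w p * sq_mass)"
    using assms by (intro sum_mono mult_left_mono line_mass_le w_nonneg) (auto simp: inj_on_def)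
  also have "\<dots> = sq_mass"
    by (simp add: sum_distrib_right[symmetric] sum_w)
  finally show ?thesis .
qed

lemma ratios_nonzero: "l \<in> ratios \<Longrightarrow> l \<noteq> 0"
  by (auto simp: ratios_def)

lemma finite_ratios: "finite ratios"
  using fin by (simp add: ratios_def)

lemma ratio_mass_le:
  assumes "l \<in> ratios"
  shows "ratio_mass l \<le> sq_mass"
  unfolding ratio_mass_def using ratios_nonzero[OF assms]
  by (intro line_mass_le) (auto simp: inj_on_def field_simps)

lemma ratio_mass_pos:
  assumes "l \<in> ratios"
  shows "ratio_mass l > 0"
proof -
  obtain p where p: "p \<in> (S - {0}) \<times> (S - {0})" "fst p / snd p = l"
    using assms by (auto simp: ratios_def)
  show ?thesis unfolding ratio_mass_def
    by (rule sum_pos2[of _ p]) (use p fin w_nonneg pos in \<open>auto simp: w_def\<close>)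
qed

section \<open>Partition of the line into cells of small mass\<close>

text \<open>The two sums are the left limit and the value at \<open>x\<close> of the distribution
  function. Using both makes an atom whose jump reaches or crosses a multiple of
  \<open>1 / t\<close> a cell of its own within \<open>S\<close>.\<close>

definition cell :: "real \<Rightarrow> real \<Rightarrow> int" where
  "cell t x = \<lfloor>t * sum f {y \<in> S. y < x}\<rfloor> + \<lfloor>t * sum f {y \<in> S. y \<le> x}\<rfloor>"

lemma cell_mono:
  assumes "t \<ge> 0" "x \<le> y"
  shows "cell t x \<le> cell t y"
  unfolding cell_def using assms fin nonneg
  by (intro add_mono floor_mono mult_left_mono sum_mono2) auto

lemma cell_range:
  assumes "t \<ge> 0"
  shows "cell t x \<in> {0..\<lfloor>2 * t\<rfloor>}"
proof -
  have le: "sum f {y \<in> S. Q y} \<le> 1" "sum f {y \<in> S. Q y} \<ge> 0" for Q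
    using fin nonneg sum_mono2[of S "{y \<in> S. Q y}" f] by (auto simp: total intro: sum_nonneg)
  have "t * sum f {y \<in> S. Q y} \<le> t" "t * sum f {y \<in> S. Q y} \<ge> 0" for Q
    using le[of Q] assms mult_left_mono[of "sum f {y \<in> S. Q y}" 1 t] by auto
  from this[of "\<lambda>y. y < x"] this[of "\<lambda>y. y \<le> x"] show ?thesis
    unfolding cell_def by (auto simp: le_floor_iff) linarith
qed

lemma cell_mass:
  assumes t: "t > 0" and xy: "x \<in> S" "y \<in> S" "x < y" and c: "cell t x = cell t y"
  shows "sum f {z \<in> S. x \<le> z \<and> z \<le> y} < 1 / t"
proof -
  define F where "F z = sum f {y \<in> S. y < z}" for z
  define G where "G z = sum f {y \<in> S. y \<le> z}" for z
  have "F x \<le> G x" "G x \<le> F y" "F y \<le> G y"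
    unfolding F_def G_def using fin nonneg xy by (auto intro!: sum_mono2)
  \<comment> \<open>The four floors increase along the chain, so equality of the two index sums
    forces all four to coincide.\<close>
  then have "\<lfloor>t * F x\<rfloor> \<le> \<lfloor>t * G x\<rfloor>" "\<lfloor>t * G x\<rfloor> \<le> \<lfloor>t * F y\<rfloor>" "\<lfloor>t * F y\<rfloor> \<le> \<lfloor>t * G y\<rfloor>"
    using t by (auto intro!: floor_mono)
  moreover have "\<lfloor>t * F x\<rfloor> + \<lfloor>t * G x\<rfloor> = \<lfloor>t * F y\<rfloor> + \<lfloor>t * G y\<rfloor>"
    using c by (simp add: cell_def F_def G_def)
  ultimately have "\<lfloor>t * F x\<rfloor> = \<lfloor>t * G y\<rfloor>" by linarith
  then have "t * G y - t * F x < 1" by linarith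
  moreover have "G y = F x + sum f {z \<in> S. x \<le> z \<and> z \<le> y}"
    unfolding F_def G_def using fin xy
    by (subst sum.union_disjoint[symmetric]) (auto intro!: sum.cong)
  ultimately show ?thesis using t by (simp add: field_simps)
qed

text \<open>A cell is either a single atom, contributing nothing, or spans an interval from its
  minimum to its maximum to which \<open>cell_mass\<close> applies.\<close>

lemma nontrivial_cell_mass:
  assumes t: "t > 0" and x: "x \<in> S"
  shows "sum f {y \<in> S. x \<noteq> y \<and> cell t x = cell t y} \<le> 1 / t"
proof -
  define C where "C = {y \<in> S. cell t y = cell t x}"
  have C: "finite C" "x \<in> C" using fin x by (auto simp: C_def)
  have m: "Min C \<in> C" "Max C \<in> C" using C by (auto intro!: Min_in Max_in)
  show ?thesis
  proof (cases "Min C < Max C")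
    case True
    have "sum f {y \<in> S. x \<noteq> y \<and> cell t x = cell t y} \<le> sum f {z \<in> S. Min C \<le> z \<and> z \<le> Max C}"
      using fin nonneg C by (intro sum_mono2) (auto simp: C_def)
    also have "\<dots> < 1 / t"
      using m True by (intro cell_mass t) (auto simp: C_def)
    finally show ?thesis by simp
  next
    case False
    then have "y = x" if "y \<in> C" for y
      using C that Min_le[of C y] Max_ge[of C y] Min_le[of C x] Max_ge[of C x] by linarith
    then have "{y \<in> S. x \<noteq> y \<and> cell t x = cell t y} = {}" by (auto simp: C_def)
    then show ?thesis using t by (simp only: sum.empty) simp
  qed
qed

lemma cell_collision_le:
  assumes t: "t > 0"
  shows "(\<Sum>x\<in>S. \<Sum>y\<in>S. f x * f y * of_bool (x \<noteq> y \<and> cell t x = cell t y)) \<le> 1 / t"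
proof -
  have "(\<Sum>x\<in>S. \<Sum>y\<in>S. f x * f y * of_bool (x \<noteq> y \<and> cell t x = cell t y)) =
      (\<Sum>x\<in>S. f x * (\<Sum>y | y \<in> S \<and> x \<noteq> y \<and> cell t x = cell t y. f y))"
    using fin
    by (simp add: sum.inter_filter sum_distrib_left of_bool_def if_distrib cong: if_cong)
  also have "\<dots> \<le> (\<Sum>x\<in>S. f x * (1 / t))"
    using t nonneg by (intro sum_mono mult_left_mono nontrivial_cell_mass) auto
  also have "\<dots> = 1 / t" by (simp only: sum_distrib_right[symmetric] total mult_1)
  finally show ?thesis .
qed

text \<open>A monotone line meets at most \<open>4 t + 1\<close> of the cells of the product partition, because
  the sum (or, for negative slope, the difference) of the two cell indices separates them.\<close>

lemma slope_energy_le_cells: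
  assumes t: "t \<ge> 1" and l: "l \<noteq> 0"
  shows "slope_energy l \<le> 5 * t * (\<Sum>p\<in>S \<times> S. \<Sum>q\<in>S \<times> S. w p * w q *
    of_bool (fst p - l * snd p = fst q - l * snd q \<and>
      cell t (fst p) = cell t (fst q) \<and> cell t (snd p) = cell t (snd q)))"
proof -
  define N where "N = \<lfloor>2 * t\<rfloor>"
  define e :: int where "e = (if l > 0 then 1 else -1)"
  define \<phi> where "\<phi> p = cell t (snd p) + e * cell t (fst p)" for p
  define L where "L = (if l > 0 then {0..2 * N} else {-N..N})"
  have N: "N \<ge> 0" "real_of_int N \<le> 2 * t" using t by (auto simp: N_def)
  have "\<phi> p \<in> L" for p
    using cell_range[of t "fst p"] cell_range[of t "snd p"] t
    by (auto simp: \<phi>_def e_def L_def N_def)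
  then have L: "finite L" "\<phi> ` (S \<times> S) \<subseteq> L" by (auto simp: L_def)
  \<comment> \<open>Both choices of \<open>L\<close> have \<open>2 * N + 1 \<le> 4 * t + 1\<close>
    elements, and \<open>t \<ge> 1\<close> absorbs the 1.\<close>
  have cardL: "real (card L) \<le> 5 * t"
    using N t by (auto simp: L_def)
  have eq: "(fst p - l * snd p = fst q - l * snd q \<and> \<phi> p = \<phi> q) \<longleftrightarrow>
      (fst p - l * snd p = fst q - l * snd q \<and>
      cell t (fst p) = cell t (fst q) \<and> cell t (snd p) = cell t (snd q))" for p q
  proof -
    have *: "cell t (fst p) = cell t (fst q) \<and> cell t (snd p) = cell t (snd q)"
      if "fst p - l * snd p = fst q - l * snd q" "\<phi> p = \<phi> q" "snd p \<le> snd q" for p q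
    proof (cases "l > 0")
      case True
      then have "l * snd p \<le> l * snd q" using that by simp
      then have "fst p \<le> fst q" using that by simp
      then have "cell t (fst p) \<le> cell t (fst q)" "cell t (snd p) \<le> cell t (snd q)"
        using that t by (auto intro!: cell_mono)
      then show ?thesis using that True by (auto simp: \<phi>_def e_def)
    next
      case False
      then have "l * snd p \<ge> l * snd q" using that by (simp add: mult_left_mono_neg)
      then have "fst p \<ge> fst q" using that by simp
      then have "cell t (fst p) \<ge> cell t (fst q)" "cell t (snd p) \<le> cell t (snd q)"
        using that t by (auto intro!: cell_mono)
      then show ?thesis using that False by (auto simp: \<phi>_def e_def)
    qed
    have "\<phi> p = \<phi> q" if "cell t (fst p) = cell t (fst q)" "cell t (snd p) = cell t (snd q)"
      using that by (simp add: \<phi>_def)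
    then show ?thesis
      using *[of p q] *[of q p] linear[of "snd p" "snd q"] by argo
  qed
  have "slope_energy l \<le> card L * (\<Sum>p\<in>S \<times> S. \<Sum>q\<in>S \<times> S.
      w p * w q * of_bool (fst p - l * snd p = fst q - l * snd q \<and> \<phi> p = \<phi> q))"
    unfolding slope_energy_def using fin L by (intro collision_sum_refine) auto
  also have "\<dots> \<le> 5 * t * (\<Sum>p\<in>S \<times> S. \<Sum>q\<in>S \<times> S.
      w p * w q * of_bool (fst p - l * snd p = fst q - l * snd q \<and> \<phi> p = \<phi> q))"
    using cardL w_nonneg by (intro mult_right_mono sum_nonneg) auto
  finally show ?thesis unfolding eq .
qed

section \<open>Slope energy summed over a set of slopes\<close>

text \<open>After \<open>slope_energy_le_cells\<close>, equal points contribute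
  \<open>sq_mass\<close> squared for each slope, while distinct points in a common cell are counted
  for at most one slope.\<close>

lemma sum_slope_energy_le_param:
  assumes t: "t \<ge> 1" and L: "finite L" "0 \<notin> L"
  shows "(\<Sum>l\<in>L. slope_energy l) \<le> 5 * t * (sq_mass\<^sup>2 * card L + (1 / t)\<^sup>2)"
proof -
  define D where "D p q = (fst p \<noteq> fst q \<and> cell t (fst p) = cell t (fst q) \<and>
    snd p \<noteq> snd q \<and> cell t (snd p) = cell t (snd q))" for p q :: "real \<times> real"
  \<comment> \<open>Distinct points on a line with \<open>l\<close> nonzero differ in both
    coordinates, so \<open>D\<close> holds and the difference quotient recovers
    \<open>l\<close>.\<close>
  have ind: "of_bool (fst p - l * snd p = fst q - l * snd q \<and>
      cell t (fst p) = cell t (fst q) \<and> cell t (snd p) = cell t (snd q)) \<le>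
      of_bool (p = q) + (of_bool (D p q) * of_bool ((fst p - fst q) / (snd p - snd q) = l) :: real)"
    if "l \<in> L" for l p q
    using that L(2) by (auto simp: D_def prod_eq_iff field_simps)
  have "(\<Sum>l\<in>L. slope_energy l) \<le> (\<Sum>l\<in>L. 5 * t * (\<Sum>p\<in>S \<times> S. \<Sum>q\<in>S \<times> S. w p * w q *
      (of_bool (p = q) + of_bool (D p q) * of_bool ((fst p - fst q) / (snd p - snd q) = l))))"
  proof (rule sum_mono)
    fix l assume l: "l \<in> L"
    then have "l \<noteq> 0" using L by auto
    note slope_energy_le_cells[OF t this]
    also have "5 * t * (\<Sum>p\<in>S \<times> S. \<Sum>q\<in>S \<times> S. w p * w q *
        of_bool (fst p - l * snd p = fst q - l * snd q \<and>
          cell t (fst p) = cell t (fst q) \<and> cell t (snd p) = cell t (snd q))) \<le>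
        5 * t * (\<Sum>p\<in>S \<times> S. \<Sum>q\<in>S \<times> S. w p * w q *
        (of_bool (p = q) + of_bool (D p q) * of_bool ((fst p - fst q) / (snd p - snd q) = l)))"
      using t w_nonneg by (intro mult_left_mono sum_mono ind l) auto
    finally show "slope_energy l \<le> 5 * t * (\<Sum>p\<in>S \<times> S. \<Sum>q\<in>S \<times> S. w p * w q *
        (of_bool (p = q) + of_bool (D p q) * of_bool ((fst p - fst q) / (snd p - snd q) = l)))" .
  qed
  also have "\<dots> = 5 * t * (\<Sum>l\<in>L. (\<Sum>p\<in>S \<times> S. \<Sum>q\<in>S \<times> S. w p * w q * of_bool (p = q)) +
      (\<Sum>p\<in>S \<times> S. \<Sum>q\<in>S \<times> S.
        w p * w q * (of_bool (D p q) * of_bool ((fst p - fst q) / (snd p - snd q) = l))))"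
    by (simp only: sum_distrib_left[symmetric] distrib_left sum.distrib)
  also have "(\<Sum>l\<in>L. (\<Sum>p\<in>S \<times> S. \<Sum>q\<in>S \<times> S. w p * w q * of_bool (p = q)) +
      (\<Sum>p\<in>S \<times> S. \<Sum>q\<in>S \<times> S.
        w p * w q * (of_bool (D p q) * of_bool ((fst p - fst q) / (snd p - snd q) = l)))) =
      card L * (\<Sum>p\<in>S \<times> S. \<Sum>q\<in>S \<times> S. w p * w q * of_bool (p = q)) +
      (\<Sum>p\<in>S \<times> S. \<Sum>q\<in>S \<times> S. \<Sum>l\<in>L.
        w p * w q * (of_bool (D p q) * of_bool ((fst p - fst q) / (snd p - snd q) = l)))"
    by (simp only: sum.distrib sum_constant)
      (subst (2) sum.swap, subst (3) sum.swap, simp)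
  also have "(\<Sum>p\<in>S \<times> S. \<Sum>q\<in>S \<times> S. w p * w q * of_bool (p = q)) = sq_mass\<^sup>2"
  proof -
    have "(\<Sum>q\<in>S \<times> S. w p * w q * of_bool (p = q)) = (w p)\<^sup>2" if "p \<in> S \<times> S" for p
    proof -
      have "(\<Sum>q\<in>S \<times> S. w p * w q * of_bool (p = q)) = (\<Sum>q\<in>S \<times> S. if p = q then w p * w q else 0)"
        by (intro sum.cong) auto
      then show ?thesis using that fin by (simp add: power2_eq_square)
    qed
    then show ?thesis by (simp add: sum_w_sq)
  qed
  also have "(\<Sum>p\<in>S \<times> S. \<Sum>q\<in>S \<times> S. \<Sum>l\<in>L.
        w p * w q * (of_bool (D p q) * of_bool ((fst p - fst q) / (snd p - snd q) = l))) \<le>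
      (\<Sum>p\<in>S \<times> S. \<Sum>q\<in>S \<times> S. w p * w q * of_bool (D p q))"
  proof (intro sum_mono)
    fix p q assume pq: "p \<in> S \<times> S" "q \<in> S \<times> S"
    have "(\<Sum>l\<in>L. w p * w q * (of_bool (D p q) * of_bool ((fst p - fst q) / (snd p - snd q) = l))) =
        (\<Sum>l\<in>L. if (fst p - fst q) / (snd p - snd q) = l then w p * w q * of_bool (D p q) else 0)"
      by (intro sum.cong) auto
    also have "\<dots> \<le> w p * w q * of_bool (D p q)"
      using L w_nonneg pq by (auto simp: sum.delta')
    finally show "(\<Sum>l\<in>L. w p * w q * (of_bool (D p q) * of_bool ((fst p - fst q) / (snd p - snd q) = l)))
        \<le> w p * w q * of_bool (D p q)" .
  qed
  \<comment> \<open>\<open>D\<close> is a conjunction of one condition per coordinate and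
    \<open>w\<close> is a product, so the sum factorises into two copies of the one-dimensional
    collision sum.\<close>
  also have "(\<Sum>p\<in>S \<times> S. \<Sum>q\<in>S \<times> S. w p * w q * of_bool (D p q)) =
      (\<Sum>x\<in>S. \<Sum>y\<in>S. f x * f y * of_bool (x \<noteq> y \<and> cell t x = cell t y))\<^sup>2"
  proof -
    let ?g = "\<lambda>x y. f x * f y * of_bool (x \<noteq> y \<and> cell t x = cell t y)"
    have "(\<Sum>p\<in>S \<times> S. \<Sum>q\<in>S \<times> S. w p * w q * of_bool (D p q)) =
        (\<Sum>a\<in>S. \<Sum>x\<in>S. \<Sum>d\<in>S. \<Sum>v\<in>S. ?g a d * ?g x v)"
      unfolding sum.cartesian_product' by (intro sum.cong) (auto simp: w_def D_def)
    also have "\<dots> = (\<Sum>a\<in>S. \<Sum>d\<in>S. \<Sum>x\<in>S. \<Sum>v\<in>S. ?g a d * ?g x v)"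
      by (rule sum.cong[OF refl], rule sum.swap)
    also have "\<dots> = (\<Sum>a\<in>S. \<Sum>d\<in>S. ?g a d) * (\<Sum>x\<in>S. \<Sum>v\<in>S. ?g x v)"
      by (simp only: sum_distrib_left[symmetric] sum_distrib_right[symmetric])
    finally show ?thesis by (simp only: power2_eq_square)
  qed
  also have "\<dots> \<le> (1 / t)\<^sup>2"
    using t nonneg by (intro power_mono cell_collision_le sum_nonneg) auto
  finally show ?thesis using t by (simp add: mult.commute)
qed

text \<open>The two terms of the parametrised bound balance at \<open>t = 1 / u\<close>, which is
  admissible when \<open>u \<le> 1\<close>; otherwise \<open>t = 1\<close> suffices, the term with
  \<open>u\<close> squared dominating.\<close>

lemma sum_slope_energy_le:
  assumes L: "finite L" "0 \<notin> L"
  shows "(\<Sum>l\<in>L. slope_energy l) \<le> 10 * sq_mass * sqrt (card L) + 10 * sq_mass\<^sup>2 * card L"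
proof (cases "L = {}")
  case False
  define u where "u = sq_mass * sqrt (card L)"
  have u: "u > 0" using False L sq_mass_pos by (simp add: u_def card_gt_0_iff)
  have u2: "u\<^sup>2 = sq_mass\<^sup>2 * card L" by (simp add: u_def power_mult_distrib)
  have "(\<Sum>l\<in>L. slope_energy l) \<le> 10 * u + 10 * u\<^sup>2"
  proof (cases "u \<le> 1")
    case True
    then have "(\<Sum>l\<in>L. slope_energy l) \<le> 5 * (1 / u) * (u\<^sup>2 + (1 / (1 / u))\<^sup>2)"
      unfolding u2 using u by (intro sum_slope_energy_le_param L) auto
    also have "\<dots> = 10 * u" using u by (simp add: field_simps power2_eq_square)
    finally show ?thesis by (simp add: add_increasing2)
  next
    case False
    then have "1 \<le> u\<^sup>2" by simp
    moreover have "(\<Sum>l\<in>L. slope_energy l) \<le> 5 * 1 * (u\<^sup>2 + (1 / 1)\<^sup>2)"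
      unfolding u2 by (intro sum_slope_energy_le_param L) auto
    ultimately show ?thesis using u by simp
  qed
  then show ?thesis unfolding u2 by (simp add: u_def mult.assoc)
qed simp

lemma sum_ratio_mass_slope_energy_le:
  "(\<Sum>l\<in>ratios. (ratio_mass l)\<^sup>2 * slope_energy l) \<le>
    40 * sq_mass\<^sup>2 * sqrt (\<Sum>l\<in>ratios. (ratio_mass l)\<^sup>2) + 40 * sq_mass\<^sup>2 * (\<Sum>l\<in>ratios. (ratio_mass l)\<^sup>2)"
proof -
  \<comment> \<open>Finitely many positive ratio masses are bounded below, so finitely many dyadic
    levels starting at \<open>sq_mass\<close> cover them all.\<close>
  have "\<exists>n. \<forall>l\<in>ratios. sq_mass / 2 ^ n < ratio_mass l"
  proof (cases "ratios = {}")
    case False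
    define m where "m = Min (ratio_mass ` ratios)"
    have m: "m > 0" "\<And>l. l \<in> ratios \<Longrightarrow> m \<le> ratio_mass l"
      using False finite_ratios ratio_mass_pos by (auto simp: m_def)
    obtain n where "sq_mass / m < 2 ^ n" using real_arch_pow[of 2] by auto
    then have "sq_mass / 2 ^ n < m" using m by (simp add: field_simps)
    then show ?thesis using m(2) by (meson less_le_trans)
  qed auto
  then obtain n where n: "\<And>l. l \<in> ratios \<Longrightarrow> sq_mass / 2 ^ n < ratio_mass l" by auto
  have "(\<Sum>l\<in>ratios. (ratio_mass l)\<^sup>2 * slope_energy l) \<le>
      4 * (10 * sq_mass) * sq_mass * sqrt (\<Sum>l\<in>ratios. (ratio_mass l)\<^sup>2) +
      4 * (10 * sq_mass\<^sup>2) * (\<Sum>l\<in>ratios. (ratio_mass l)\<^sup>2)"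
  proof (rule sum_square_weight_le)
    fix L' assume "L' \<subseteq> ratios"
    then show "(\<Sum>l\<in>L'. slope_energy l) \<le> 10 * sq_mass * sqrt (card L') + 10 * sq_mass\<^sup>2 * card L'"
      using finite_ratios ratios_nonzero by (intro sum_slope_energy_le) (auto intro: finite_subset)
  qed (use finite_ratios n slope_energy_nonneg ratio_mass_le sq_mass_pos in auto)
  then show ?thesis by (simp add: power2_eq_square)
qed


section \<open>Commuting pairs by their off-diagonal entries\<close>

text \<open>A sum rather than \<open>f 0\<close>, because 0 may lie outside \<open>S\<close>, where
  \<open>f\<close> is arbitrary.\<close>

definition zero_mass :: real where
  "zero_mass = (\<Sum>x\<in>S. f x * of_bool (x = 0))"

definition energy :: real where
  "energy = (\<Sum>p\<in>(S - {0}) \<times> (S - {0}). \<Sum>q\<in>(S - {0}) \<times> (S - {0}).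
     w p * w q * of_bool (fst p / snd p = fst q / snd q))"

text \<open>Two matrices with off-diagonal entries \<open>b, c\<close> and \<open>y, z\<close> enter as \<open>u = (b, y)\<close> and
  \<open>v = (c, z)\<close>; the pairs \<open>p\<close> and \<open>q\<close> hold their upper and lower diagonal entries.\<close>

definition commuting :: "real \<times> real \<Rightarrow> real \<times> real \<Rightarrow> real \<times> real \<Rightarrow> real \<times> real \<Rightarrow> bool" where
  "commuting u v p q \<longleftrightarrow> fst u * snd v = fst v * snd u \<and>
     (fst p - fst q) * snd u = fst u * (snd p - snd q) \<and>
     (fst p - fst q) * snd v = fst v * (snd p - snd q)"

text \<open>The conditional probability of commuting, given the off-diagonal entries.\<close>

definition diagonal_mass :: "real \<times> real \<Rightarrow> real \<times> real \<Rightarrow> real" where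
  "diagonal_mass u v = (\<Sum>p\<in>S \<times> S. \<Sum>q\<in>S \<times> S. w p * w q * of_bool (commuting u v p q))"

lemma energy_eq: "energy = (\<Sum>l\<in>ratios. (ratio_mass l)\<^sup>2)"
  unfolding energy_def ratio_mass_def ratios_def using fin by (intro collision_sum) auto

lemma zero_mass_bounds: "0 \<le> zero_mass" "zero_mass \<le> 1"
proof -
  show "0 \<le> zero_mass" unfolding zero_mass_def using nonneg by (intro sum_nonneg) auto
  have "zero_mass \<le> sum f S" unfolding zero_mass_def using nonneg by (intro sum_mono) auto
  then show "zero_mass \<le> 1" by (simp add: total)
qed

lemma sum_w_zero:
  "(\<Sum>u\<in>S \<times> S. w u * of_bool (fst u = 0)) = zero_mass"
  "(\<Sum>u\<in>S \<times> S. w u * of_bool (snd u = 0)) = zero_mass"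
  "(\<Sum>u\<in>S \<times> S. w u * of_bool (u = (0, 0))) = zero_mass\<^sup>2"
proof -
  have "(\<Sum>u\<in>S \<times> S. w u * of_bool (fst u = 0)) = (\<Sum>x\<in>S. \<Sum>y\<in>S. (f x * of_bool (x = 0)) * f y)"
    unfolding sum.cartesian_product' by (intro sum.cong) (auto simp: w_def)
  also have "\<dots> = zero_mass"
    by (simp only: sum_distrib_left[symmetric] sum_distrib_right[symmetric] total zero_mass_def mult_1_right)
  finally show "(\<Sum>u\<in>S \<times> S. w u * of_bool (fst u = 0)) = zero_mass" .
  have "(\<Sum>u\<in>S \<times> S. w u * of_bool (snd u = 0)) = (\<Sum>x\<in>S. \<Sum>y\<in>S. f x * (f y * of_bool (y = 0)))"
    unfolding sum.cartesian_product' by (intro sum.cong) (auto simp: w_def)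
  also have "\<dots> = zero_mass"
    by (simp only: sum_distrib_left[symmetric] sum_distrib_right[symmetric] total zero_mass_def mult_1_left)
  finally show "(\<Sum>u\<in>S \<times> S. w u * of_bool (snd u = 0)) = zero_mass" .
  have "(\<Sum>u\<in>S \<times> S. w u * of_bool (u = (0, 0))) =
      (\<Sum>x\<in>S. \<Sum>y\<in>S. (f x * of_bool (x = 0)) * (f y * of_bool (y = 0)))"
    unfolding sum.cartesian_product' by (intro sum.cong) (auto simp: w_def)
  also have "\<dots> = zero_mass\<^sup>2"
    by (simp only: sum_distrib_left[symmetric] sum_distrib_right[symmetric] zero_mass_def power2_eq_square)
  finally show "(\<Sum>u\<in>S \<times> S. w u * of_bool (u = (0, 0))) = zero_mass\<^sup>2" .
qed

lemma sum_w_same_coordinate: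
  "(\<Sum>p\<in>S \<times> S. \<Sum>q\<in>S \<times> S. w p * w q * of_bool (fst p = fst q)) = sq_mass"
  "(\<Sum>p\<in>S \<times> S. \<Sum>q\<in>S \<times> S. w p * w q * of_bool (snd p = snd q)) = sq_mass"
proof -
  have "(\<Sum>p | p \<in> S \<times> S \<and> fst p = x. w p) = f x" if "x \<in> S" for x
  proof -
    have "{p. p \<in> S \<times> S \<and> fst p = x} = {x} \<times> S" using that by auto
    then have "(\<Sum>p | p \<in> S \<times> S \<and> fst p = x. w p) = (\<Sum>y\<in>S. f x * f y)"
      by (simp only: sum.cartesian_product') (simp add: w_def)
    then show ?thesis by (simp only: sum_distrib_left[symmetric] total mult_1_right)
  qed
  then show "(\<Sum>p\<in>S \<times> S. \<Sum>q\<in>S \<times> S. w p * w q * of_bool (fst p = fst q)) = sq_mass"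
    using fin by (subst collision_sum[where K = S]) (auto simp: sq_mass_def)
  have "(\<Sum>p | p \<in> S \<times> S \<and> snd p = y. w p) = f y" if "y \<in> S" for y
  proof -
    have "{p. p \<in> S \<times> S \<and> snd p = y} = S \<times> {y}" using that by auto
    then have "(\<Sum>p | p \<in> S \<times> S \<and> snd p = y. w p) = (\<Sum>x\<in>S. f x * f y)"
      by (simp only: sum.cartesian_product') (simp add: w_def)
    then show ?thesis by (simp only: sum_distrib_right[symmetric] total mult_1_left)
  qed
  then show "(\<Sum>p\<in>S \<times> S. \<Sum>q\<in>S \<times> S. w p * w q * of_bool (snd p = snd q)) = sq_mass"
    using fin by (subst collision_sum[where K = S]) (auto simp: sq_mass_def)
qed

lemma diagonal_mass_le:
  assumes "\<And>p q. commuting u v p q \<Longrightarrow> Q p q"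
  shows "diagonal_mass u v \<le> (\<Sum>p\<in>S \<times> S. \<Sum>q\<in>S \<times> S. w p * w q * of_bool (Q p q))"
  unfolding diagonal_mass_def using w_nonneg assms by (intro sum_mono mult_left_mono) auto

text \<open>When both coordinates of \<open>x\<close> are nonzero, the commutation equation
  belonging to \<open>x\<close> alone says that \<open>p\<close> and \<open>q\<close> lie on a
  common line of slope \<open>fst x / snd x\<close>.\<close>

lemma diagonal_mass_le_slope_energy:
  assumes "fst x \<noteq> 0" "snd x \<noteq> 0" "x = u \<or> x = v"
  shows "diagonal_mass u v \<le> slope_energy (fst x / snd x)"
  unfolding slope_energy_def
  by (rule diagonal_mass_le) (use assms in \<open>auto simp: commuting_def field_simps\<close>)

lemma diagonal_mass_le_cases:
  "diagonal_mass u v \<le> of_bool (u = (0, 0)) * of_bool (v = (0, 0)) +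
     sq_mass * (of_bool (fst u = 0) * of_bool (fst v = 0) + of_bool (snd u = 0) * of_bool (snd v = 0) +
       of_bool (u = (0, 0)) + of_bool (v = (0, 0))) +
     of_bool (u \<in> (UNIV - {0}) \<times> (UNIV - {0}) \<and> v \<in> (UNIV - {0}) \<times> (UNIV - {0})) *
       (of_bool (fst u / snd u = fst v / snd v) * slope_energy (fst u / snd u))"
    (is "_ \<le> ?Z + sq_mass * ?D + ?E")
proof -
  have nn: "?Z \<ge> 0" "?D \<ge> 0" "?E \<ge> 0" by (auto simp: slope_energy_nonneg)
  have D: ?thesis if "diagonal_mass u v \<le> sq_mass" "?D \<ge> 1"
  proof -
    have "sq_mass * 1 \<le> sq_mass * ?D"
      using that(2) sq_mass_nonneg by (intro mult_left_mono) auto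
    then show ?thesis using that(1) nn by linarith
  qed
  have sq: "sq_mass * ?D \<ge> 0" using nn sq_mass_nonneg by simp
  obtain b y where u: "u = (b, y)" by force
  obtain c z where v: "v = (c, z)" by force
  \<comment> \<open>Unless \<open>b * z\<close> and \<open>c * y\<close> differ, one zero entry
    forces an adjacent one. The cases are: both matrices diagonal; only the first diagonal, hence
    scalar; only the second; both lower triangular; both upper triangular; no zero entries; no
    commutation.\<close>
  consider "b = 0" "c = 0" "y = 0" "z = 0" | "b = 0" "c = 0" "y \<noteq> 0 \<or> z \<noteq> 0"
    | "y = 0" "z = 0" "b \<noteq> 0 \<or> c \<noteq> 0" | "b = 0" "y = 0" "c \<noteq> 0" "z \<noteq> 0"
    | "c = 0" "z = 0" "b \<noteq> 0" "y \<noteq> 0" | "b \<noteq> 0" "c \<noteq> 0" "y \<noteq> 0" "z \<noteq> 0" "b / y = c / z"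
    | "b * z \<noteq> c * y"
    by (cases "b = 0"; cases "c = 0"; cases "y = 0"; cases "z = 0") (simp_all add: field_simps, blast)
  then show ?thesis
  proof cases
    case 1
    have "diagonal_mass u v \<le> (\<Sum>p\<in>S \<times> S. \<Sum>q\<in>S \<times> S. w p * w q * of_bool True)"
      by (rule diagonal_mass_le) simp
    also have "\<dots> = 1" by (simp add: sum_distrib_left[symmetric] sum_w)
    also have "1 \<le> ?Z" using 1 u v by simp
    finally show ?thesis using nn sq by linarith
  next
    case 2
    have "diagonal_mass u v \<le> (\<Sum>p\<in>S \<times> S. \<Sum>q\<in>S \<times> S. w p * w q * of_bool (fst p = fst q))"
      by (rule diagonal_mass_le) (use 2 u v in \<open>auto simp: commuting_def\<close>)
    then show ?thesis using 2 u v by (intro D) (auto simp: sum_w_same_coordinate)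
  next
    case 3
    have "diagonal_mass u v \<le> (\<Sum>p\<in>S \<times> S. \<Sum>q\<in>S \<times> S. w p * w q * of_bool (snd p = snd q))"
      by (rule diagonal_mass_le) (use 3 u v in \<open>auto simp: commuting_def\<close>)
    then show ?thesis using 3 u v by (intro D) (auto simp: sum_w_same_coordinate)
  next
    case 4
    then have "diagonal_mass u v \<le> slope_energy (fst v / snd v)"
      using v by (intro diagonal_mass_le_slope_energy) auto
    also have "\<dots> \<le> sq_mass" using 4 v by (intro slope_energy_le) auto
    finally show ?thesis by (rule D) (use 4 u v in auto)
  next
    case 5
    then have "diagonal_mass u v \<le> slope_energy (fst u / snd u)"
      using u by (intro diagonal_mass_le_slope_energy) auto
    also have "\<dots> \<le> sq_mass" using 5 u by (intro slope_energy_le) auto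
    finally show ?thesis by (rule D) (use 5 u v in auto)
  next
    case 6
    then have "diagonal_mass u v \<le> slope_energy (fst u / snd u)"
      using u by (intro diagonal_mass_le_slope_energy) auto
    also have "\<dots> = ?E" using 6 u v by simp
    finally show ?thesis using nn sq by linarith
  next
    case 7
    have "diagonal_mass u v \<le> (\<Sum>p\<in>S \<times> S. \<Sum>q\<in>S \<times> S. w p * w q * of_bool False)"
      by (rule diagonal_mass_le) (use 7 u v in \<open>auto simp: commuting_def\<close>)
    also have "\<dots> = 0" by simp
    finally show ?thesis using nn sq by linarith
  qed
qed

lemma commuting_mass_le:
  "(\<Sum>u\<in>S \<times> S. \<Sum>v\<in>S \<times> S. w u * w v * diagonal_mass u v) \<le>
    40 * (sq_mass\<^sup>2 * sqrt energy + sq_mass\<^sup>2 * energy + sq_mass ^ 3 + zero_mass ^ 3)"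
proof -
  let ?S2 = "S \<times> S"
  let ?P = "(S - {0}) \<times> (S - {0})"
  define F where "F u v = of_bool (fst u / snd u = fst v / snd v) * slope_energy (fst u / snd u)"
    for u v :: "real \<times> real"
  define N where "N u v = (u \<in> (UNIV - {0}) \<times> (UNIV - {0}) \<and> v \<in> (UNIV - {0}) \<times> (UNIV - {0}))"
    for u v :: "real \<times> real"
  define z where "z = zero_mass"
  have prod: "(\<Sum>u\<in>?S2. \<Sum>v\<in>?S2. (w u * g u) * (w v * h v)) =
      (\<Sum>u\<in>?S2. w u * g u) * (\<Sum>v\<in>?S2. w v * h v)" for g h
    by (simp only: sum_product)
  have "(\<Sum>u\<in>?S2. \<Sum>v\<in>?S2. w u * w v * diagonal_mass u v) \<le>
      (\<Sum>u\<in>?S2. \<Sum>v\<in>?S2. w u * w v * (of_bool (u = (0, 0)) * of_bool (v = (0, 0)) +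
        sq_mass * (of_bool (fst u = 0) * of_bool (fst v = 0) + of_bool (snd u = 0) * of_bool (snd v = 0) +
          of_bool (u = (0, 0)) + of_bool (v = (0, 0))) + of_bool (N u v) * F u v))"
    unfolding N_def F_def using w_nonneg
    by (intro sum_mono mult_left_mono diagonal_mass_le_cases) auto
  also have "\<dots> = (\<Sum>u\<in>?S2. \<Sum>v\<in>?S2. (w u * of_bool (u = (0, 0))) * (w v * of_bool (v = (0, 0)))) +
      sq_mass * ((\<Sum>u\<in>?S2. \<Sum>v\<in>?S2. (w u * of_bool (fst u = 0)) * (w v * of_bool (fst v = 0))) +
        (\<Sum>u\<in>?S2. \<Sum>v\<in>?S2. (w u * of_bool (snd u = 0)) * (w v * of_bool (snd v = 0))) +
        (\<Sum>u\<in>?S2. \<Sum>v\<in>?S2. (w u * of_bool (u = (0, 0))) * (w v * 1)) +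
        (\<Sum>u\<in>?S2. \<Sum>v\<in>?S2. (w u * 1) * (w v * of_bool (v = (0, 0))))) +
      (\<Sum>u\<in>?S2. \<Sum>v\<in>?S2. w u * w v * (of_bool (N u v) * F u v))"
    unfolding sum_distrib_left sum.distrib[symmetric]
    by (intro sum.cong refl) (simp add: algebra_simps)
  also have "\<dots> = z ^ 4 + 4 * (sq_mass * z\<^sup>2) +
      (\<Sum>u\<in>?S2. \<Sum>v\<in>?S2. w u * w v * (of_bool (N u v) * F u v))"
    unfolding prod sum_w_zero using sum_w by (simp add: z_def power2_eq_square power4_eq_xxxx)
  also have "(\<Sum>u\<in>?S2. \<Sum>v\<in>?S2. w u * w v * (of_bool (N u v) * F u v)) =
      (\<Sum>u\<in>?P. \<Sum>v\<in>?P. w u * w v * F u v)"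
    unfolding sum.cartesian_product using fin
    by (intro sum.mono_neutral_cong_right) (auto simp: N_def)
  \<comment> \<open>Group the pairs \<open>u\<close>, \<open>v\<close> by their common ratio; the
    slope energy depends on this ratio only.\<close>
  also have "\<dots> = (\<Sum>l\<in>ratios. (ratio_mass l)\<^sup>2 * slope_energy l)"
    unfolding F_def ratio_mass_def ratios_def using fin by (intro collision_sum_weighted) auto
  also have "\<dots> \<le> 40 * sq_mass\<^sup>2 * sqrt energy + 40 * sq_mass\<^sup>2 * energy"
    using sum_ratio_mass_slope_energy_le by (simp only: energy_eq)
  finally have main: "(\<Sum>u\<in>?S2. \<Sum>v\<in>?S2. w u * w v * diagonal_mass u v) \<le>
      z ^ 4 + 4 * (sq_mass * z\<^sup>2) + (40 * sq_mass\<^sup>2 * sqrt energy + 40 * sq_mass\<^sup>2 * energy)"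
    by simp
  have z: "0 \<le> z" "z \<le> 1" using zero_mass_bounds by (auto simp: z_def)
  have z4: "z ^ 4 \<le> z ^ 3" using z by (intro power_decreasing) auto
  have cubes: "0 \<le> z ^ 3" "0 \<le> sq_mass ^ 3" using z sq_mass_nonneg by auto
  \<comment> \<open>The mixed term is at most the cube of the larger of its two factors.\<close>
  have "sq_mass * z\<^sup>2 \<le> sq_mass ^ 3 + z ^ 3"
  proof (cases "sq_mass \<le> z")
    case True
    then have "sq_mass * z\<^sup>2 \<le> z * z\<^sup>2" by (intro mult_right_mono) auto
    then show ?thesis using cubes by (simp add: power3_eq_cube power2_eq_square)
  next
    case False
    then have "sq_mass * z\<^sup>2 \<le> sq_mass * sq_mass\<^sup>2"
      using z sq_mass_nonneg by (intro mult_left_mono power_mono) auto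
    then show ?thesis using cubes by (simp add: power3_eq_cube power2_eq_square)
  qed
  then show ?thesis using main z4 cubes unfolding z_def[symmetric] distrib_left mult.assoc
    by linarith
qed

end

section \<open>From matrices to finite weights\<close>

text \<open>The diagonal entries of the commutator are opposite, leaving three equations: the
  vanishing minors of the two vectors in the overview.\<close>

lemma matrix_2_commute_iff:
  fixes X Y :: "real^2^2"
  shows "X ** Y = Y ** X \<longleftrightarrow> X$1$2 * Y$2$1 = X$2$1 * Y$1$2 \<and>
    (X$1$1 - X$2$2) * Y$1$2 = X$1$2 * (Y$1$1 - Y$2$2) \<and>
    (X$1$1 - X$2$2) * Y$2$1 = X$2$1 * (Y$1$1 - Y$2$2)"
  by (simp add: vec_eq_iff forall_2 matrix_matrix_mult_def sum_2) (auto simp: algebra_simps)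

lemma finite_weight_pmf:
  assumes "finite (set_pmf \<nu>)"
  shows "finite_weight (set_pmf \<nu>) (pmf \<nu>)"
  using assms by unfold_locales (auto simp: pmf_positive sum_pmf_eq_1)

lemma commuting_prob_mat_pmf:
  assumes "finite (set_pmf \<nu>)"
  defines "S \<equiv> set_pmf \<nu>" and "f \<equiv> pmf \<nu>"
  shows "commuting_prob (mat_pmf \<nu>) = (\<Sum>u\<in>S \<times> S. \<Sum>v\<in>S \<times> S.
    finite_weight.w f u * finite_weight.w f v * finite_weight.diagonal_mass S f u v)"
proof -
  interpret finite_weight S f
    unfolding S_def f_def using assms(1) by (rule finite_weight_pmf)
  let ?S2 = "S \<times> S"
  let ?M = "set_pmf (mat_pmf \<nu>)"
  define mk :: "real \<Rightarrow> real \<Rightarrow> real \<Rightarrow> real \<Rightarrow> real^2^2"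
    where "mk a b c d = vector [vector [a, b], vector [c, d]]" for a b c d
  have mk: "mk a b c d $ 1 $ 1 = a" "mk a b c d $ 1 $ 2 = b"
      "mk a b c d $ 2 $ 1 = c" "mk a b c d $ 2 $ 2 = d" for a b c d
    by (simp_all add: mk_def)
  have mk_entries: "mk (X$1$1) (X$1$2) (X$2$1) (X$2$2) = X" for X
    by (simp add: vec_eq_iff forall_2 mk)
  have M: "X \<in> ?M \<longleftrightarrow> X$1$1 \<in> S \<and> X$1$2 \<in> S \<and> X$2$1 \<in> S \<and> X$2$2 \<in> S" for X
    by (simp add: S_def set_pmf_iff pmf_mat_pmf)
  have "(\<Sum>u\<in>?S2. \<Sum>v\<in>?S2. w u * w v * diagonal_mass u v) =
      (\<Sum>((u, v), (p, q))\<in>(?S2 \<times> ?S2) \<times> (?S2 \<times> ?S2).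
        w u * w v * (w p * w q * of_bool (commuting u v p q)))"
    by (simp add: diagonal_mass_def sum_distrib_left sum.cartesian_product')
  also have "\<dots> = (\<Sum>(X, Y)\<in>?M \<times> ?M.
      pmf (mat_pmf \<nu>) X * pmf (mat_pmf \<nu>) Y * of_bool (X ** Y = Y ** X))"
    \<comment> \<open>The eight entries are regrouped by position: upper right, lower left, then the
      two diagonal places, each holding one entry of either matrix.\<close>
    by (rule sum.reindex_bij_witness[where
          i = "\<lambda>(X, Y). (((X$1$2, Y$1$2), (X$2$1, Y$2$1)), ((X$1$1, Y$1$1), (X$2$2, Y$2$2)))" and
          j = "\<lambda>(((b, y), (c, z)), ((a, x), (d, v))). (mk a b c d, mk x y z v)"])
      (auto simp: M mk mk_entries w_def pmf_mat_pmf commuting_def matrix_2_commute_iff f_def[symmetric])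
  also have "\<dots> = commuting_prob (mat_pmf \<nu>)"
    by (simp add: commuting_prob_def sum.cartesian_product)
  finally show ?thesis by simp
qed

lemma mult_energy_eq:
  assumes "finite (set_pmf \<nu>)"
  shows "mult_energy \<nu> = finite_weight.energy (set_pmf \<nu>) (pmf \<nu>)"
proof -
  interpret finite_weight "set_pmf \<nu>" "pmf \<nu>"
    using assms by (rule finite_weight_pmf)
  show ?thesis
    unfolding mult_energy_def energy_def sum.cartesian_product' by (simp add: w_def mult.assoc)
qed

lemma zero_mass_pmf:
  assumes "finite (set_pmf \<nu>)"
  shows "finite_weight.zero_mass (set_pmf \<nu>) (pmf \<nu>) = pmf \<nu> 0"
proof -
  interpret finite_weight "set_pmf \<nu>" "pmf \<nu>"
    using assms by (rule finite_weight_pmf)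
  have "zero_mass = (\<Sum>x\<in>set_pmf \<nu>. if x = 0 then pmf \<nu> x else 0)"
    unfolding zero_mass_def by (intro sum.cong) auto
  also have "\<dots> = pmf \<nu> 0"
    using assms by (simp add: pmf_eq_0_set_pmf)
  finally show ?thesis .
qed

lemma lp_norm_2_eq:
  assumes "finite (set_pmf \<nu>)"
  shows "lp_norm 2 \<nu> = sqrt (finite_weight.sq_mass (set_pmf \<nu>) (pmf \<nu>))"
proof -
  interpret finite_weight "set_pmf \<nu>" "pmf \<nu>"
    using assms by (rule finite_weight_pmf)
  have "(\<Sum>x\<in>set_pmf \<nu>. pmf \<nu> x powr 2) = sq_mass"
    unfolding sq_mass_def by (intro sum.cong) (auto simp: pmf_positive)
  then show ?thesis
    using sq_mass_nonneg by (simp add: lp_norm_def powr_half_sqrt)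
qed

lemma sq_mass_le_linf_norm:
  assumes "finite (set_pmf \<nu>)"
  shows "finite_weight.sq_mass (set_pmf \<nu>) (pmf \<nu>) \<le> linf_norm \<nu>"
proof -
  interpret finite_weight "set_pmf \<nu>" "pmf \<nu>"
    using assms by (rule finite_weight_pmf)
  \<comment> \<open>Finiteness of the range, which adds at most the value 0 to the masses on the
    support, is what makes \<open>Max\<close> in \<open>linf_norm\<close> an upper bound.\<close>
  have "range (pmf \<nu>) \<subseteq> insert 0 (pmf \<nu> ` set_pmf \<nu>)"
    by (auto simp: set_pmf_iff)
  then have "finite (range (pmf \<nu>))"
    using assms by (meson finite_imageI finite_insert finite_subset)
  then have "pmf \<nu> x \<le> linf_norm \<nu>" for x
    by (simp add: linf_norm_def)
  then have "sq_mass \<le> (\<Sum>x\<in>set_pmf \<nu>. linf_norm \<nu> * pmf \<nu> x)"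
    unfolding sq_mass_def power2_eq_square by (intro sum_mono mult_right_mono) auto
  also have "\<dots> = linf_norm \<nu>"
    by (simp only: sum_distrib_left[symmetric] total mult_1_right)
  finally show ?thesis .
qed

theorem theorem1p2:
  shows "\<exists>C::real. C > 0 \<and> (\<forall>\<nu>::real pmf. finite (set_pmf \<nu>) \<longrightarrow>
    \<bar>commuting_prob (mat_pmf \<nu>)\<bar> \<le>
      C * (lp_norm 2 \<nu> ^ 4 * mult_energy \<nu> powr (1 / 2) + linf_norm \<nu> ^ 2 * mult_energy \<nu>
           + lp_norm 2 \<nu> ^ 6 + pmf \<nu> 0 ^ 3))"
proof (intro exI[of _ 40] conjI allI impI)
  fix \<nu> :: "real pmf"
  assume fin_\<nu>: "finite (set_pmf \<nu>)"
  interpret finite_weight "set_pmf \<nu>" "pmf \<nu>"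
    using fin_\<nu> by (rule finite_weight_pmf)
  have E: "energy \<ge> 0" unfolding energy_eq by (intro sum_nonneg) auto
  have lp: "lp_norm 2 \<nu> ^ 4 = sq_mass\<^sup>2" "lp_norm 2 \<nu> ^ 6 = sq_mass ^ 3"
    using sq_mass_nonneg power_mult[of "sqrt sq_mass" 2 2] power_mult[of "sqrt sq_mass" 2 3]
    by (simp_all add: lp_norm_2_eq[OF fin_\<nu>])
  \<comment> \<open>The bound proved has \<open>sq_mass\<close> squared before the energy; it is
    weakened here to the squared maximum norm.\<close>
  have "sq_mass\<^sup>2 * energy \<le> linf_norm \<nu> ^ 2 * energy"
    using sq_mass_nonneg sq_mass_le_linf_norm[OF fin_\<nu>] E by (intro mult_right_mono power_mono) auto
  moreover have "\<bar>commuting_prob (mat_pmf \<nu>)\<bar> = commuting_prob (mat_pmf \<nu>)"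
    by (simp add: commuting_prob_def sum_nonneg)
  ultimately show "\<bar>commuting_prob (mat_pmf \<nu>)\<bar> \<le>
      40 * (lp_norm 2 \<nu> ^ 4 * mult_energy \<nu> powr (1 / 2) + linf_norm \<nu> ^ 2 * mult_energy \<nu>
           + lp_norm 2 \<nu> ^ 6 + pmf \<nu> 0 ^ 3)"
    using commuting_mass_le E
    by (simp add: commuting_prob_mat_pmf[OF fin_\<nu>] mult_energy_eq[OF fin_\<nu>]
        zero_mass_pmf[OF fin_\<nu>] lp powr_half_sqrt)
qed simp

end
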